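(* Let $\mathcal{M} = (\mathcal{S},\mathcal{A},\Psi,\mathcal{R},p)$ be the MDP of the multi-period newsvendor problem with discount factor $\gamma=0$, and let $\mathcal{M}''/\!\sim$ be the single-state quotient MDP defined in the context. Then $$\Lambda(\pi)(a\mid s_t) = \pi(a-F_t\mid\mathcal{S})\qquad\text{for all }(s_t,a)\in\Psi$$ defines an injective mapping $\Lambda\colon\Pi_*(\mathcal{M}''/\!\sim)\to\Pi_*(\mathcal{M})$.
   Context: **MDPs.** A Markov decision process (MDP) is a tuple $(\mathcal{S}, \mathcal{A}, \Psi, \mathcal{R}, p)$ where $\mathcal{S}$ is a countable set of states, $\mathcal{A}$ is a set of actions, $\Psi \subseteq \mathcal{S}\times\mathcal{A}$ is the set of admissible state-action pairs such that $\mathcal{A}(s) = \{a \in \mathcal{A} \mid (s,a)\in\Psi\}$ is nonempty and finite for every $s$, $\mathcal{R}\subseteq\mathbb{R}$ is a bounded set of rewards, and $p\colon \mathcal{S}\times\mathcal{R}\times\Psi\to[0,1]$, written $p(s',r\mid s,a)$, satisfies $\sum_{s'\in\mathcal{S}, r\in\mathcal{R}} p(s',r\mid s,a) = 1$ for all $(s,a)\in\Psi$. A policy is a map $\pi\colon\Psi\to[0,1]$, written $\pi(a\mid s)$, with $\sum_{a\in\mathcal{A}(s)}\pi(a\mid s)=1$ for all $s$. The discount factor is $0$ for all MDPs here, so the value function is $V_\pi(s) = \mathbb{E}_{\pi,p}[R_1\mid S_0=s]$, the expected first reward when starting in $s$ and following $\pi$. A policy $\pi$ is optimal if $V_\pi(s)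 = \sup_{\tilde\pi}V_{\tilde\pi}(s)$ for all $s$, the supremum being over all policies. $\Pi_*(\mathcal{N})$ is the set of optimal policies of an MDP $\mathcal{N}$. **Multi-period newsvendor problem.** Data: i.i.d. integer-valued bounded random variables $(\delta_t)_{t\in\mathbb{N}_0}$ (deviations) whose set of possible values is $\mathbb{Z}_\delta\subseteq\mathbb{Z}$; natural numbers $F_t$, $t \in \mathbb{N}_0$ (forecasts), such that there is a constant $C$ with $0\le F_t+\delta_t<C$ for all $t$; real numbers $0<C_p<C_s$. For $a\in F_t+\mathbb{Z}_\delta$ and $d\in\mathbb{Z}_\delta$ let $\operatorname{Rew}_t(a,d) = \min\{F_t+d,a\}C_s - aC_p$; the same formula is used for $a=F_t$. The MDP $\mathcal{M} = (\mathcal{S},\mathcal{A},\Psi,\mathcal{R},p)$ has states $\mathcal{S} = \{s_t\mid t\in\mathbb{N}_0\}$ (pairwise distinct), $\mathcal{A}(s_t) = F_t+\mathbb{Z}_\delta$, $\mathcal{A} = \bigcup_{s\in\mathcal{S}}\mathcal{A}(s)$, $\Psi = \{(s,a)\mid s\in\mathcal{S}, a\in\mathcal{A}(s)\}$, $\mathcal{R} = \bigcup_{t\in\mathbb{N}_0}\operatorname{Rew}_t(F_t+\mathbb{Z}_\delta,\mathbb{Z}_\delta)$, and $p(s_l,r\mid s_t,a) = \sum_{d\in\mathbb{Z}_\delta,\ r=\operatorname{Rew}_t(a,d)}\Pr\{\delta_t=d\}$ if $l=t+1$ and $0$ otherwise. As in the deterministic case (where $\delta_t=0$), the policy $\pi_*^{\det}(s_t)=F_t$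 is regarded as a policy in $\mathcal{M}$, so $0\in\mathbb{Z}_\delta$. **Transformed MDPs.** $\mathcal{M}' = (\mathcal{S},\mathcal{A},\Psi,\mathcal{R}',p')$ has $\mathcal{R}' = \{r_1-r_2\mid r_1,r_2\in\mathcal{R}\}$ and $p'(s_l,r\mid s_t,a) = \sum_{d\in D'(r,t,a)}\Pr\{\delta_t=d\}$ if $l=t+1$ and $0$ otherwise, where $D'(r,t,a) = \{d\in\mathbb{Z}_\delta\mid r=\operatorname{Rew}_t(a,d)-\operatorname{Rew}_t(F_t,d)\}$. $\mathcal{M}'' = (\mathcal{S},\mathcal{A}',\Psi',\mathcal{R}',p'')$ has $\mathcal{A}'=\mathcal{A}'(s_t)=\mathbb{Z}_\delta$, $\Psi'=\mathcal{S}\times\mathbb{Z}_\delta$ and $p''(s_l,r\mid s_t,a') = p'(s_l,r\mid s_t,a'+F_t)$. **Quotient.** The relation $\sim$ identifies all states of $\mathcal{M}''$ with each other and identifies state-action pairs of $\mathcal{M}''$ having the same action. The quotient MDP $\mathcal{M}''/\!\sim$ has the single state $\mathcal{S}$ (state set $\{\mathcal{S}\}$), action set $\mathbb{Z}_\delta$, admissible pairs $\{\mathcal{S}\}\times\mathbb{Z}_\delta$, reward set $\mathcal{R}'$, and dynamic $\overline{p}(\mathcal{S},r\mid\mathcal{S},a) = p''(s_1,r\mid s_0,a)$. *)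

theory Defs
  imports "HOL-Probability.Probability"
begin

section \<open>Markov decision processes with discount factor 0\<close>

text \<open>\<open>dyn N s' r s a\<close> is $p(s',r \mid s,a)$; only its values for \<open>s' \<in> states N\<close>,
  \<open>r \<in> rewards N\<close> and \<open>(s, a) \<in> admissible N\<close> are meaningful.\<close>

record ('s, 'a) mdp =
  states :: "'s set"
  actions :: "'a set"
  admissible :: "('s \<times> 'a) set"
  rewards :: "real set"
  dyn :: "'s \<Rightarrow> real \<Rightarrow> 's \<Rightarrow> 'a \<Rightarrow> real"

definition actions_at :: "('s, 'a) mdp \<Rightarrow> 's \<Rightarrow> 'a set" where
  "actions_at N s = {a \<in> actions N. (s, a) \<in> admissible N}"

definition is_mdp :: "('s, 'a) mdp \<Rightarrow> bool" where
  "is_mdp N \<longleftrightarrow>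
     countable (states N) \<and>
     admissible N \<subseteq> states N \<times> actions N \<and>
     (\<forall>s \<in> states N. finite (actions_at N s) \<and> actions_at N s \<noteq> {}) \<and>
     bounded (rewards N) \<and>
     (\<forall>s' \<in> states N. \<forall>r \<in> rewards N. \<forall>(s, a) \<in> admissible N. dyn N s' r s a \<in> {0..1}) \<and>
     (\<forall>(s, a) \<in> admissible N.
        ((\<lambda>(s', r). dyn N s' r s a) has_sum 1) (states N \<times> rewards N))"

text \<open>\<open>\<pi> (s, a)\<close> is $\pi(a \mid s)$. A policy has domain \<open>admissible N\<close>, hence the
  extensional function space: two policies are equal iff they agree on \<open>admissible N\<close>.\<close>

definition policies :: "('s, 'a) mdp \<Rightarrow> ('s \<times> 'a \<Rightarrow> real) set" where
  "policies N =
     {\<pi> \<in> admissible N \<rightarrow>\<^sub>E {0..1}. \<forall>s \<in> states N. (\<Sum>a \<in> actions_at N s. \<pi> (s, a)) = 1}"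

definition action_pmf :: "('s, 'a) mdp \<Rightarrow> ('s \<times> 'a \<Rightarrow> real) \<Rightarrow> 's \<Rightarrow> 'a pmf" where
  "action_pmf N \<pi> s = embed_pmf (\<lambda>a. if a \<in> actions_at N s then \<pi> (s, a) else 0)"

definition transition_pmf :: "('s, 'a) mdp \<Rightarrow> 's \<Rightarrow> 'a \<Rightarrow> ('s \<times> real) pmf" where
  "transition_pmf N s a =
     embed_pmf (\<lambda>(s', r). if s' \<in> states N \<and> r \<in> rewards N then dyn N s' r s a else 0)"

text \<open>The joint law of $(S_1, R_1)$ given $S_0 = s$ under the policy \<open>\<pi>\<close>.\<close>

definition first_step_pmf ::
    "('s, 'a) mdp \<Rightarrow> ('s \<times> 'a \<Rightarrow> real) \<Rightarrow> 's \<Rightarrow> ('s \<times> real) pmf" where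
  "first_step_pmf N \<pi> s = bind_pmf (action_pmf N \<pi> s) (transition_pmf N s)"

text \<open>For discount factor 0 the value is $\mathbb{E}_{\pi,p}[R_1 \mid S_0 = s]$.\<close>

definition val :: "('s, 'a) mdp \<Rightarrow> ('s \<times> 'a \<Rightarrow> real) \<Rightarrow> 's \<Rightarrow> real" where
  "val N \<pi> s = measure_pmf.expectation (first_step_pmf N \<pi> s) snd"

definition optimal_policies :: "('s, 'a) mdp \<Rightarrow> ('s \<times> 'a \<Rightarrow> real) set" where
  "optimal_policies N =
     {\<pi> \<in> policies N. \<forall>s \<in> states N. val N \<pi> s = (SUP \<rho> \<in> policies N. val N \<rho> s)}"


section \<open>The multi-period newsvendor problem\<close>

record ('w, 's) newsvendor =
  nv_space :: "'w measure"
  deviation :: "nat \<Rightarrow> 'w \<Rightarrow> int"  \<comment> \<open>$\delta_t$\<close>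
  dev_values :: "int set"  \<comment> \<open>$\mathbb{Z}_\delta$\<close>
  forecast :: "nat \<Rightarrow> nat"  \<comment> \<open>$F_t$\<close>
  Cp :: real
  Cs :: real
  nv_state :: "nat \<Rightarrow> 's"  \<comment> \<open>$s_t$\<close>

definition is_newsvendor :: "('w, 's) newsvendor \<Rightarrow> bool" where
  "is_newsvendor D \<longleftrightarrow>
     prob_space (nv_space D) \<and>
     prob_space.indep_vars (nv_space D) (\<lambda>_. count_space UNIV) (deviation D) UNIV \<and>
     (\<forall>t. distr (nv_space D) (count_space UNIV) (deviation D t) =
          distr (nv_space D) (count_space UNIV) (deviation D 0)) \<and>
     (\<forall>t. deviation D t ` space (nv_space D) = dev_values D) \<and>
     (\<exists>B. \<forall>t. \<forall>w \<in> space (nv_space D). \<bar>deviation D t w\<bar> \<le> B) \<and>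
     0 \<in> dev_values D \<and>
     (\<exists>C. \<forall>t. \<forall>w \<in> space (nv_space D).
        0 \<le> int (forecast D t) + deviation D t w \<and> int (forecast D t) + deviation D t w < C) \<and>
     0 < Cp D \<and> Cp D < Cs D \<and>
     inj (nv_state D)"

definition dev_prob :: "('w, 's) newsvendor \<Rightarrow> nat \<Rightarrow> int \<Rightarrow> real" where
  "dev_prob D t d = measure (nv_space D) {w \<in> space (nv_space D). deviation D t w = d}"

definition Rew :: "('w, 's) newsvendor \<Rightarrow> nat \<Rightarrow> int \<Rightarrow> int \<Rightarrow> real" where
  "Rew D t a d = of_int (min (int (forecast D t) + d) a) * Cs D - of_int a * Cp D"

definition nv_states :: "('w, 's) newsvendor \<Rightarrow> 's set" where
  "nv_states D = range (nv_state D)"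

definition period :: "('w, 's) newsvendor \<Rightarrow> 's \<Rightarrow> nat" where
  "period D = inv (nv_state D)"

definition orders :: "('w, 's) newsvendor \<Rightarrow> nat \<Rightarrow> int set" where
  "orders D t = (\<lambda>d. int (forecast D t) + d) ` dev_values D"

definition nv_mdp :: "('w, 's) newsvendor \<Rightarrow> ('s, int) mdp" where
  "nv_mdp D =
    \<lparr> states = nv_states D,
      actions = (\<Union>t. orders D t),
      admissible = {(s, a). s \<in> nv_states D \<and> a \<in> orders D (period D s)},
      rewards = (\<Union>t. {Rew D t a d | a d. a \<in> orders D t \<and> d \<in> dev_values D}),
      dyn = (\<lambda>s' r s a. let t = period D s in
        if period D s' = t + 1
        then \<Sum>d \<in> {d \<in> dev_values D. r = Rew D t a d}. dev_prob D t d
        else 0) \<rparr>"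

text \<open>$\mathcal{M}'$: rewards relative to ordering the forecast.\<close>

definition nv_mdp' :: "('w, 's) newsvendor \<Rightarrow> ('s, int) mdp" where
  "nv_mdp' D =
    \<lparr> states = states (nv_mdp D),
      actions = actions (nv_mdp D),
      admissible = admissible (nv_mdp D),
      rewards = {r1 - r2 | r1 r2. r1 \<in> rewards (nv_mdp D) \<and> r2 \<in> rewards (nv_mdp D)},
      dyn = (\<lambda>s' r s a. let t = period D s in
        if period D s' = t + 1
        then \<Sum>d \<in> {d \<in> dev_values D. r = Rew D t a d - Rew D t (int (forecast D t)) d}.
               dev_prob D t d
        else 0) \<rparr>"

text \<open>$\mathcal{M}''$: actions relative to the forecast.\<close>

definition nv_mdp'' :: "('w, 's) newsvendor \<Rightarrow> ('s, int) mdp" where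
  "nv_mdp'' D =
    \<lparr> states = states (nv_mdp' D),
      actions = dev_values D,
      admissible = states (nv_mdp' D) \<times> dev_values D,
      rewards = rewards (nv_mdp' D),
      dyn = (\<lambda>s' r s a. dyn (nv_mdp' D) s' r s (a + int (forecast D (period D s)))) \<rparr>"

text \<open>$\mathcal{M}''/{\sim}$: its only state is the set of all states of $\mathcal{M}''$.\<close>

definition nv_quotient :: "('w, 's) newsvendor \<Rightarrow> ('s set, int) mdp" where
  "nv_quotient D =
    \<lparr> states = {nv_states D},
      actions = dev_values D,
      admissible = {nv_states D} \<times> dev_values D,
      rewards = rewards (nv_mdp'' D),
      dyn = (\<lambda>_ r _ a. dyn (nv_mdp'' D) (nv_state D 1) r (nv_state D 0) a) \<rparr>"

definition Lambda :: "('w, 's) newsvendor \<Rightarrow> ('s set \<times> int \<Rightarrow> real) \<Rightarrow> ('s \<times> int \<Rightarrow> real)" where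
  "Lambda D \<pi> =
     (\<lambda>(s, a) \<in> admissible (nv_mdp D). \<pi> (nv_states D, a - int (forecast D (period D s))))"

section \<open>The newsvendor MDPs are MDPs\<close>

context
  fixes D :: "('w, 's) newsvendor"
  assumes D: "is_newsvendor D"
begin

lemma period_state [simp]: "period D (nv_state D t) = t"
  using D by (simp add: is_newsvendor_def period_def)

lemma finite_dev_values: "finite (dev_values D)"
proof -
  obtain B where B: "\<forall>t. \<forall>w \<in> space (nv_space D). \<bar>deviation D t w\<bar> \<le> B"
    using D unfolding is_newsvendor_def by metis
  have im: "deviation D 0 ` space (nv_space D) = dev_values D"
    using D unfolding is_newsvendor_def by blast
  have "\<bar>d\<bar> \<le> B" if "d \<in> dev_values D" for d
    using that B unfolding im[symmetric] by blast
  then have "dev_values D \<subseteq> {-B..B}"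
    by (auto simp: abs_le_iff) (smt (verit))
  then show ?thesis
    by (rule finite_subset) simp
qed

lemma forecast_bound:
  obtains C where "\<And>t d. d \<in> dev_values D \<Longrightarrow>
    0 \<le> int (forecast D t) + d \<and> int (forecast D t) + d < C"
proof -
  obtain C where C: "\<forall>t. \<forall>w \<in> space (nv_space D).
      0 \<le> int (forecast D t) + deviation D t w \<and> int (forecast D t) + deviation D t w < C"
    using D unfolding is_newsvendor_def by metis
  have "deviation D t ` space (nv_space D) = dev_values D" for t
    using D unfolding is_newsvendor_def by blast
  then show ?thesis
    using C that[of C] by (metis imageE)
qed

lemma sum_dev_prob: "(\<Sum>d \<in> dev_values D. dev_prob D t d) = 1"
proof -
  interpret prob_space "nv_space D"
    using D by (simp add: is_newsvendor_def)
  have [measurable]: "deviation D t \<in> measurable (nv_space D) (count_space UNIV)"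
    using D by (auto simp: is_newsvendor_def indep_vars_def)
  have im: "deviation D t ` space (nv_space D) = dev_values D"
    using D unfolding is_newsvendor_def by blast
  have "(\<Sum>d \<in> dev_values D. dev_prob D t d) =
      prob (\<Union>d \<in> dev_values D. {w \<in> space (nv_space D). deviation D t w = d})"
    unfolding dev_prob_def
    by (rule finite_measure_finite_Union[symmetric])
       (auto simp: finite_dev_values disjoint_family_on_def)
  also have "(\<Union>d \<in> dev_values D. {w \<in> space (nv_space D). deviation D t w = d}) =
      space (nv_space D)"
    using im by auto
  finally show ?thesis
    by (simp add: prob_space)
qed

lemma dev_prob_nonneg: "0 \<le> dev_prob D t d"
  by (simp add: dev_prob_def)

lemma sum_dev_prob_in_unit:
  assumes "A \<subseteq> dev_values D"
  shows "(\<Sum>d \<in> A. dev_prob D t d) \<in> {0..1}"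
  using sum_mono2[OF finite_dev_values assms, of "dev_prob D t"] sum_dev_prob[of t]
  by (auto simp: dev_prob_nonneg intro!: sum_nonneg)

lemma has_sum_dev_prob:
  assumes "\<And>d. d \<in> dev_values D \<Longrightarrow> f d \<in> R" and "x \<in> S"
    and "\<And>s'. s' \<in> S \<Longrightarrow> Q s' \<longleftrightarrow> s' = x"
  shows "((\<lambda>(s', r). if Q s' then \<Sum>d \<in> {d \<in> dev_values D. r = f d}. dev_prob D t d else 0)
           has_sum 1) (S \<times> R)"
proof -
  let ?g = "\<lambda>(s', r). if Q s' then \<Sum>d \<in> {d \<in> dev_values D. r = f d}. dev_prob D t d else 0"
  let ?T = "{x} \<times> f ` dev_values D"
  have "sum ?g ?T = (\<Sum>r \<in> f ` dev_values D. \<Sum>d \<in> {d \<in> dev_values D. f d = r}. dev_prob D t d)"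
    using assms by (simp add: sum.cartesian_product[symmetric] eq_commute)
  also have "\<dots> = 1"
    using sum.image_gen[OF finite_dev_values, of "dev_prob D t" f] sum_dev_prob[of t] by simp
  finally have "(?g has_sum 1) ?T"
    using has_sum_finite[of ?T ?g] finite_dev_values by simp
  also have "?this \<longleftrightarrow> (?g has_sum 1) (S \<times> R)"
  proof (rule has_sum_cong_neutral)
    fix y assume y: "y \<in> S \<times> R - ?T"
    obtain s' r where y_eq: "y = (s', r)" by (cases y)
    show "?g y = 0"
    proof (cases "Q s'")
      case True
      then have "{d \<in> dev_values D. r = f d} = {}"
        using y assms unfolding y_eq by auto
      then show ?thesis
        unfolding y_eq by (simp only: prod.case sum.empty if_cancel)
    qed (simp add: y_eq)
  qed (use assms in auto)
  finally show ?thesis .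
qed

lemma bounded_rewards: "bounded (rewards (nv_mdp D))"
proof -
  obtain C where C: "\<And>t d. d \<in> dev_values D \<Longrightarrow>
      0 \<le> int (forecast D t) + d \<and> int (forecast D t) + d < C"
    using forecast_bound by blast
  have "rewards (nv_mdp D) \<subseteq> (\<lambda>(m, a). of_int m * Cs D - of_int a * Cp D) ` ({0..C} \<times> {0..C})"
  proof
    fix r assume "r \<in> rewards (nv_mdp D)"
    then obtain t a d where r: "r = Rew D t a d" and a: "a \<in> orders D t" and d: "d \<in> dev_values D"
      by (auto simp: nv_mdp_def)
    have "a \<in> {0..C}"
      using a C[of _ t] by (auto simp: orders_def less_imp_le)
    moreover have "min (int (forecast D t) + d) a \<in> {0..C}"
      using C[OF d, of t] calculation by auto
    ultimately show "r \<in> (\<lambda>(m, a). of_int m * Cs D - of_int a * Cp D) ` ({0..C} \<times> {0..C})"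
      unfolding r Rew_def by (intro image_eqI[of _ _ "(min (int (forecast D t) + d) a, a)"]) simp_all
  qed
  then show ?thesis
    by (rule bounded_subset[rotated]) (intro finite_imp_bounded finite_imageI, simp)
qed

lemma bounded_rewards': "bounded (rewards (nv_mdp' D))"
proof -
  obtain B where B: "\<And>x. x \<in> rewards (nv_mdp D) \<Longrightarrow> norm x \<le> B"
    using bounded_rewards unfolding bounded_iff by blast
  have "norm z \<le> B + B" if z_mem: "z \<in> rewards (nv_mdp' D)" for z
  proof -
    obtain x y where z: "z = x - y" and xy: "x \<in> rewards (nv_mdp D)" "y \<in> rewards (nv_mdp D)"
      using z_mem by (auto simp: nv_mdp'_def)
    show ?thesis
      unfolding z using norm_triangle_ineq4[of x y] B[OF xy(1)] B[OF xy(2)] by linarith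
  qed
  then show ?thesis
    unfolding bounded_iff by blast
qed

lemma zero_dev: "0 \<in> dev_values D"
  using D by (simp add: is_newsvendor_def)

lemma forecast_in_orders: "int (forecast D t) \<in> orders D t"
  using zero_dev by (force simp: orders_def)

lemma dev_rewards:
  assumes "a \<in> orders D t" "d \<in> dev_values D"
  shows "Rew D t a d \<in> rewards (nv_mdp D)"
  using assms by (auto simp: nv_mdp_def)

lemma dev_rewards':
  assumes "a \<in> orders D t" "d \<in> dev_values D"
  shows "Rew D t a d - Rew D t (int (forecast D t)) d \<in> rewards (nv_mdp' D)"
  using dev_rewards[OF assms] dev_rewards[OF forecast_in_orders assms(2)]
  by (auto simp: nv_mdp'_def)

lemma states_simps:
  "states (nv_mdp D) = nv_states D" "states (nv_mdp' D) = nv_states D"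
  "states (nv_mdp'' D) = nv_states D"
  by (simp_all add: nv_mdp_def nv_mdp'_def nv_mdp''_def)

lemma period_next: "s' \<in> nv_states D \<Longrightarrow> period D s' = t + 1 \<longleftrightarrow> s' = nv_state D (t + 1)"
  by (auto simp: nv_states_def)

lemma actions_at_nv: "s \<in> nv_states D \<Longrightarrow> actions_at (nv_mdp D) s = orders D (period D s)"
  by (auto simp: actions_at_def nv_mdp_def)

lemma is_mdp_nv_mdp: "is_mdp (nv_mdp D)"
  unfolding is_mdp_def
proof (intro conjI ballI)
  show "countable (states (nv_mdp D))"
    by (simp add: nv_mdp_def nv_states_def)
  show "admissible (nv_mdp D) \<subseteq> states (nv_mdp D) \<times> actions (nv_mdp D)"
    by (auto simp: nv_mdp_def)
  show "bounded (rewards (nv_mdp D))"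
    by (rule bounded_rewards)
  fix s assume "s \<in> states (nv_mdp D)"
  then have "actions_at (nv_mdp D) s = orders D (period D s)"
    by (simp add: states_simps actions_at_nv)
  then show "finite (actions_at (nv_mdp D) s)" "actions_at (nv_mdp D) s \<noteq> {}"
    using finite_dev_values zero_dev by (auto simp: orders_def)
next
  fix s' r sa
  show "case sa of (s, a) \<Rightarrow> dyn (nv_mdp D) s' r s a \<in> {0..1}"
    using sum_dev_prob_in_unit[of "{d \<in> dev_values D. r = Rew D (period D (fst sa)) (snd sa) d}"]
    by (auto simp: nv_mdp_def Let_def split: prod.splits)
next
  fix sa assume "sa \<in> admissible (nv_mdp D)"
  then have "snd sa \<in> orders D (period D (fst sa))"
    by (auto simp: nv_mdp_def)
  then have "((\<lambda>(s', r). if period D s' = period D (fst sa) + 1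
      then \<Sum>d \<in> {d \<in> dev_values D. r = Rew D (period D (fst sa)) (snd sa) d}.
          dev_prob D (period D (fst sa)) d else 0) has_sum 1)
      (nv_states D \<times> rewards (nv_mdp D))"
    by (intro has_sum_dev_prob[where x = "nv_state D (period D (fst sa) + 1)"] dev_rewards
          period_next) (auto simp: nv_states_def)
  then show "case sa of (s, a) \<Rightarrow>
      ((\<lambda>(s', r). dyn (nv_mdp D) s' r s a) has_sum 1) (states (nv_mdp D) \<times> rewards (nv_mdp D))"
    unfolding states_simps by (cases sa) (simp add: nv_mdp_def Let_def cong: if_cong)
qed

lemma is_mdp_nv_mdp': "is_mdp (nv_mdp' D)"
  unfolding is_mdp_def
proof (intro conjI ballI)
  note M = is_mdp_nv_mdp[unfolded is_mdp_def]
  have eq: "states (nv_mdp' D) = states (nv_mdp D)" "actions (nv_mdp' D) = actions (nv_mdp D)"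
    "admissible (nv_mdp' D) = admissible (nv_mdp D)"
    "actions_at (nv_mdp' D) = actions_at (nv_mdp D)"
    by (simp_all add: nv_mdp'_def actions_at_def fun_eq_iff)
  show "countable (states (nv_mdp' D))"
    and "admissible (nv_mdp' D) \<subseteq> states (nv_mdp' D) \<times> actions (nv_mdp' D)"
    using M unfolding eq by blast+
  show "bounded (rewards (nv_mdp' D))"
    by (rule bounded_rewards')
  fix s assume "s \<in> states (nv_mdp' D)"
  then show "finite (actions_at (nv_mdp' D) s)" "actions_at (nv_mdp' D) s \<noteq> {}"
    using M unfolding eq by blast+
next
  fix s' r sa
  show "case sa of (s, a) \<Rightarrow> dyn (nv_mdp' D) s' r s a \<in> {0..1}"
    using sum_dev_prob_in_unit[of "{d \<in> dev_values D. r = Rew D (period D (fst sa)) (snd sa) d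
        - Rew D (period D (fst sa)) (int (forecast D (period D (fst sa)))) d}"]
    by (auto simp: nv_mdp'_def Let_def split: prod.splits)
next
  fix sa assume "sa \<in> admissible (nv_mdp' D)"
  then have "snd sa \<in> orders D (period D (fst sa))"
    by (auto simp: nv_mdp'_def nv_mdp_def)
  then have "((\<lambda>(s', r). if period D s' = period D (fst sa) + 1
      then \<Sum>d \<in> {d \<in> dev_values D. r = Rew D (period D (fst sa)) (snd sa) d
        - Rew D (period D (fst sa)) (int (forecast D (period D (fst sa)))) d}.
          dev_prob D (period D (fst sa)) d else 0) has_sum 1)
      (nv_states D \<times> rewards (nv_mdp' D))"
    by (intro has_sum_dev_prob[where x = "nv_state D (period D (fst sa) + 1)"] dev_rewards'
          period_next) (auto simp: nv_states_def)
  then show "case sa of (s, a) \<Rightarrow>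
      ((\<lambda>(s', r). dyn (nv_mdp' D) s' r s a) has_sum 1) (states (nv_mdp' D) \<times> rewards (nv_mdp' D))"
    unfolding states_simps by (cases sa) (simp add: nv_mdp'_def Let_def cong: if_cong)
qed

lemma admissible_shift:
  "s \<in> nv_states D \<Longrightarrow> a \<in> dev_values D \<Longrightarrow>
    (s, a + int (forecast D (period D s))) \<in> admissible (nv_mdp' D)"
  by (auto simp: nv_mdp'_def nv_mdp_def orders_def)

lemma is_mdp_nv_mdp'': "is_mdp (nv_mdp'' D)"
  unfolding is_mdp_def
proof (intro conjI ballI)
  note M = is_mdp_nv_mdp'[unfolded is_mdp_def states_simps]
  have rew: "rewards (nv_mdp'' D) = rewards (nv_mdp' D)"
    by (simp add: nv_mdp''_def)
  have dyn: "dyn (nv_mdp'' D) s' r s a = dyn (nv_mdp' D) s' r s (a + int (forecast D (period D s)))"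
    for s' r s a
    by (simp add: nv_mdp''_def)
  have adm: "(fst sa, snd sa + int (forecast D (period D (fst sa)))) \<in> admissible (nv_mdp' D)"
    if "sa \<in> admissible (nv_mdp'' D)" for sa
    using that by (intro admissible_shift) (auto simp: nv_mdp''_def states_simps)
  show "countable (states (nv_mdp'' D))"
    by (simp add: states_simps nv_states_def)
  show "admissible (nv_mdp'' D) \<subseteq> states (nv_mdp'' D) \<times> actions (nv_mdp'' D)"
    by (simp add: nv_mdp''_def)
  show "bounded (rewards (nv_mdp'' D))"
    unfolding rew by (rule bounded_rewards')
  show "finite (actions_at (nv_mdp'' D) s)" "actions_at (nv_mdp'' D) s \<noteq> {}"
    if "s \<in> states (nv_mdp'' D)" for s
  proof -
    have "actions_at (nv_mdp'' D) s = dev_values D"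
      using that by (auto simp: actions_at_def nv_mdp''_def)
    then show "finite (actions_at (nv_mdp'' D) s)" "actions_at (nv_mdp'' D) s \<noteq> {}"
      using finite_dev_values zero_dev by auto
  qed
  show "case sa of (s, a) \<Rightarrow> dyn (nv_mdp'' D) s' r s a \<in> {0..1}"
    if "s' \<in> states (nv_mdp'' D)" "r \<in> rewards (nv_mdp'' D)" "sa \<in> admissible (nv_mdp'' D)"
    for s' r sa
  proof -
    have "\<forall>s' \<in> nv_states D. \<forall>r \<in> rewards (nv_mdp' D).
        \<forall>(s, a) \<in> admissible (nv_mdp' D). dyn (nv_mdp' D) s' r s a \<in> {0..1}"
      using M by blast
    from this[rule_format, OF _ _ adm[OF that(3)], of s' r] show ?thesis
      using that unfolding rew states_simps dyn by (simp add: case_prod_beta)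
  qed
  show "case sa of (s, a) \<Rightarrow> ((\<lambda>(s', r). dyn (nv_mdp'' D) s' r s a) has_sum 1)
      (states (nv_mdp'' D) \<times> rewards (nv_mdp'' D))"
    if "sa \<in> admissible (nv_mdp'' D)" for sa
  proof -
    have "\<forall>(s, a) \<in> admissible (nv_mdp' D).
        ((\<lambda>(s', r). dyn (nv_mdp' D) s' r s a) has_sum 1) (nv_states D \<times> rewards (nv_mdp' D))"
      using M by blast
    from this[rule_format, OF adm[OF that]] show ?thesis
      unfolding rew states_simps dyn by (simp add: case_prod_beta)
  qed
qed

lemma is_mdp_nv_quotient: "is_mdp (nv_quotient D)"
  unfolding is_mdp_def
proof (intro conjI ballI)
  have rew: "rewards (nv_quotient D) = rewards (nv_mdp' D)"
    by (simp add: nv_quotient_def nv_mdp''_def)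
  show "countable (states (nv_quotient D))"
    and "admissible (nv_quotient D) \<subseteq> states (nv_quotient D) \<times> actions (nv_quotient D)"
    by (simp_all add: nv_quotient_def)
  show "bounded (rewards (nv_quotient D))"
    unfolding rew by (rule bounded_rewards')
  fix s assume "s \<in> states (nv_quotient D)"
  then have "actions_at (nv_quotient D) s = dev_values D"
    by (auto simp: actions_at_def nv_quotient_def)
  then show "finite (actions_at (nv_quotient D) s)" "actions_at (nv_quotient D) s \<noteq> {}"
    using finite_dev_values zero_dev by auto
next
  fix s' r sa
  show "case sa of (s, a) \<Rightarrow> dyn (nv_quotient D) s' r s a \<in> {0..1}"
    using sum_dev_prob_in_unit[of "{d \<in> dev_values D.
        r = Rew D 0 (snd sa + int (forecast D 0)) d - Rew D 0 (int (forecast D 0)) d}" 0]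
    by (auto simp: nv_quotient_def nv_mdp''_def nv_mdp'_def Let_def split: prod.splits)
next
  fix sa assume "sa \<in> admissible (nv_quotient D)"
  then have "snd sa + int (forecast D 0) \<in> orders D 0"
    by (auto simp: nv_quotient_def orders_def)
  then have "((\<lambda>(s', r). if True
      then \<Sum>d \<in> {d \<in> dev_values D. r = Rew D 0 (snd sa + int (forecast D 0)) d
        - Rew D 0 (int (forecast D 0)) d}. dev_prob D 0 d else 0) has_sum 1)
      ({nv_states D} \<times> rewards (nv_mdp' D))"
    by (intro has_sum_dev_prob[where x = "nv_states D"] dev_rewards') auto
  then show "case sa of (s, a) \<Rightarrow> ((\<lambda>(s', r). dyn (nv_quotient D) s' r s a) has_sum 1)
      (states (nv_quotient D) \<times> rewards (nv_quotient D))"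
    by (cases sa) (simp add: nv_quotient_def nv_mdp''_def nv_mdp'_def Let_def)
qed

end

end

theory Submission
  imports Defs
begin

text \<open>For discount factor 0 the value of a policy at a state is the average, weighted by the
  policy, of the expected immediate rewards of the actions there (\<open>val_eq_sum\<close>). With
  \<open>x\<close> units ordered on top of the forecast, $\operatorname{Rew}_t(F_t+x,d) =
  F_t(C_s-C_p) + \min\{d,x\}C_s - xC_p$, so the dependence on \<open>t\<close> is an
  additive term that does not involve the action, and after subtracting the reward of ordering
  the forecast nothing depends on \<open>t\<close> at all (\<open>Rew_relative\<close>). As the deviations are
  identically distributed, the expected reward of the action \<open>x + F\<^sub>t\<close> at \<open>s\<^sub>t\<close> is that
  of \<open>x\<close> in the quotient plus a constant \<open>c\<^sub>t\<close>.

  Hence a policy of the newsvendor MDP whose action weights at \<open>s\<^sub>t\<close> are those of a quotient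
  policy, shifted by \<open>F\<^sub>t\<close>, has at \<open>s\<^sub>t\<close> the value of that quotient policy plus \<open>c\<^sub>t\<close>
  (\<open>val_shift\<close>). This applies to the image of a quotient policy under \<open>\<Lambda>\<close>, and, for a fixed
  \<open>t\<close>, every policy of the newsvendor MDP restricts at \<open>s\<^sub>t\<close> to some quotient policy
  (\<open>slice_policy\<close>). So a competitor that beats \<open>\<Lambda> \<pi>\<close> at \<open>s\<^sub>t\<close> would yield a competitor that
  beats \<open>\<pi>\<close>. Injectivity holds because the weights of \<open>\<pi>\<close> can be read off \<open>\<Lambda> \<pi>\<close> at
  \<open>s\<^sub>0\<close>.\<close>

section \<open>Values and optimality for finitely many actions\<close>

lemma pmf_action_pmf:
  assumes fin: "finite (actions_at N s)" and s: "s \<in> states N" and \<pi>: "\<pi> \<in> policies N"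
  shows "pmf (action_pmf N \<pi> s) a = (if a \<in> actions_at N s then \<pi> (s, a) else 0)"
  unfolding action_pmf_def
proof (rule pmf_embed_pmf)
  have nonneg: "0 \<le> \<pi> (s, a)" if "a \<in> actions_at N s" for a
    using that \<pi> by (fastforce simp: policies_def actions_at_def)
  then show "0 \<le> (if a \<in> actions_at N s then \<pi> (s, a) else 0)" for a
    by simp
  have "(\<integral>\<^sup>+ a. ennreal (if a \<in> actions_at N s then \<pi> (s, a) else 0) \<partial>count_space UNIV) =
      (\<Sum>a \<in> actions_at N s. ennreal (if a \<in> actions_at N s then \<pi> (s, a) else 0))"
    by (rule nn_integral_count_space'[OF fin]) auto
  also have "\<dots> = ennreal (\<Sum>a \<in> actions_at N s. \<pi> (s, a))"
    by (simp add: sum_ennreal nonneg)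
  also have "\<dots> = 1"
    using \<pi> s by (simp add: policies_def)
  finally show "(\<integral>\<^sup>+ a. ennreal (if a \<in> actions_at N s then \<pi> (s, a) else 0) \<partial>count_space UNIV) = 1" .
qed

lemma val_eq_sum:
  assumes fin: "finite (actions_at N s)" and s: "s \<in> states N" and \<pi>: "\<pi> \<in> policies N"
    and fin_step: "\<And>a. a \<in> actions_at N s \<Longrightarrow> finite (set_pmf (transition_pmf N s a))"
  shows "val N \<pi> s =
    (\<Sum>a \<in> actions_at N s. \<pi> (s, a) * measure_pmf.expectation (transition_pmf N s a) snd)"
proof -
  have "set_pmf (action_pmf N \<pi> s) \<subseteq> actions_at N s"
    by (auto simp: set_pmf_eq pmf_action_pmf[OF fin s \<pi>])
  then show ?thesis
    unfolding val_def first_step_pmf_def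
    by (subst pmf_expectation_bind[OF fin fin_step])
       (auto simp: pmf_action_pmf[OF fin s \<pi>])
qed

text \<open>The bound on the values is needed for the supremum over all policies to be meaningful:
  for real-valued \<open>Sup\<close> an unbounded set has an unspecified supremum.\<close>

lemma optimal_policy_val_ge:
  assumes \<pi>: "\<pi> \<in> optimal_policies N" and \<rho>: "\<rho> \<in> policies N" and s: "s \<in> states N"
    and fin: "finite (actions_at N s)"
    and fin_step: "\<And>a. a \<in> actions_at N s \<Longrightarrow> finite (set_pmf (transition_pmf N s a))"
  shows "val N \<rho> s \<le> val N \<pi> s"
proof -
  let ?q = "\<lambda>a. measure_pmf.expectation (transition_pmf N s a) snd"
  have "val N \<sigma> s \<le> (\<Sum>a \<in> actions_at N s. \<bar>?q a\<bar>)" if \<sigma>: "\<sigma> \<in> policies N" for \<sigma>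
    unfolding val_eq_sum[OF fin s \<sigma> fin_step, simplified]
  proof (rule sum_mono)
    fix a assume "a \<in> actions_at N s"
    then have "0 \<le> \<sigma> (s, a)" "\<sigma> (s, a) \<le> 1"
      using \<sigma> by (fastforce simp: policies_def actions_at_def)+
    then have "\<sigma> (s, a) * ?q a \<le> \<sigma> (s, a) * \<bar>?q a\<bar>" "\<sigma> (s, a) * \<bar>?q a\<bar> \<le> 1 * \<bar>?q a\<bar>"
      by (intro mult_left_mono mult_right_mono; simp)+
    then show "\<sigma> (s, a) * ?q a \<le> \<bar>?q a\<bar>"
      by linarith
  qed
  then have "bdd_above ((\<lambda>\<sigma>. val N \<sigma> s) ` policies N)"
    by (rule bdd_aboveI2)
  then show ?thesis
    using cSUP_upper[OF \<rho>] \<pi> s by (simp add: optimal_policies_def)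
qed

lemma optimal_policyI:
  assumes "\<pi> \<in> policies N"
    and "\<And>\<rho> s. \<rho> \<in> policies N \<Longrightarrow> s \<in> states N \<Longrightarrow> val N \<rho> s \<le> val N \<pi> s"
  shows "\<pi> \<in> optimal_policies N"
  using assms by (auto simp: optimal_policies_def intro!: cSup_eq_maximum[symmetric])

lemma embed_pmf_pmf: "embed_pmf (pmf p) = p"
  by (rule type_definition.Rep_inverse[OF td_pmf_embed_pmf])

lemma pmf_map_pmf_sum:
  assumes "finite A" and "set_pmf p \<subseteq> A"
  shows "pmf (map_pmf h p) y = (\<Sum>d \<in> {d \<in> A. y = h d}. pmf p d)"
proof -
  have "pmf (map_pmf h p) y = measure (measure_pmf p) (h -` {y} \<inter> set_pmf p)"
    by (simp add: pmf_map measure_Int_set_pmf)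
  also have "h -` {y} \<inter> set_pmf p = {d \<in> A. y = h d} \<inter> set_pmf p"
    using assms by auto
  also have "measure (measure_pmf p) \<dots> = (\<Sum>d \<in> {d \<in> A. y = h d}. pmf p d)"
    using assms by (simp add: measure_Int_set_pmf measure_measure_pmf_finite)
  finally show ?thesis .
qed

section \<open>Rewards relative to the forecast\<close>

text \<open>Each side is $\min\{d,x\}C_s - xC_p - \min\{d,0\}C_s$, in which the forecast has
  cancelled.\<close>

lemma Rew_relative:
  "Rew D t (x + int (forecast D t)) d - Rew D t (int (forecast D t)) d =
   Rew D u (x + int (forecast D u)) d - Rew D u (int (forecast D u)) d"
proof -
  have "min (int (forecast D v) + d) (x + int (forecast D v)) = int (forecast D v) + min d x"
    "min (int (forecast D v) + d) (int (forecast D v)) = int (forecast D v) + min d 0" for v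
    by auto
  then show ?thesis
    by (simp add: Rew_def algebra_simps del: of_int_min)
qed

section \<open>The newsvendor MDP and its quotient\<close>

definition dev_pmf :: "('w, 's) newsvendor \<Rightarrow> int pmf" where
  "dev_pmf D = embed_pmf (dev_prob D 0)"

context
  fixes D :: "('w, 's) newsvendor"
  assumes D: "is_newsvendor D"
begin

lemma dev_prob_time_invariant: "dev_prob D t d = dev_prob D 0 d"
proof -
  interpret prob_space "nv_space D"
    using D by (simp add: is_newsvendor_def)
  have meas: "deviation D t \<in> measurable (nv_space D) (count_space UNIV)" for t
    using D by (auto simp: is_newsvendor_def indep_vars_def)
  have "dev_prob D t d = measure (distr (nv_space D) (count_space UNIV) (deviation D t)) {d}" for t
    by (subst measure_distr[OF meas])
       (auto simp: dev_prob_def intro!: arg_cong[where f = "measure (nv_space D)"])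
  moreover have "distr (nv_space D) (count_space UNIV) (deviation D t) =
      distr (nv_space D) (count_space UNIV) (deviation D 0)"
    using D unfolding is_newsvendor_def by blast
  ultimately show ?thesis
    by simp
qed

lemma dev_prob_eq_0:
  assumes "d \<notin> dev_values D"
  shows "dev_prob D t d = 0"
proof -
  have "deviation D t ` space (nv_space D) = dev_values D"
    using D unfolding is_newsvendor_def by blast
  then have "{w \<in> space (nv_space D). deviation D t w = d} = {}"
    using assms by auto
  then show ?thesis
    unfolding dev_prob_def by (simp only: measure_empty)
qed

lemma pmf_dev_pmf: "pmf (dev_pmf D) d = dev_prob D t d"
proof -
  have "pmf (dev_pmf D) d = dev_prob D 0 d"
    unfolding dev_pmf_def
  proof (rule pmf_embed_pmf)
    have "(\<integral>\<^sup>+ d. ennreal (dev_prob D 0 d) \<partial>count_space UNIV) =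
        (\<Sum>d \<in> dev_values D. ennreal (dev_prob D 0 d))"
      by (rule nn_integral_count_space'[OF finite_dev_values[OF D]])
         (auto simp: dev_prob_eq_0)
    also have "\<dots> = 1"
      by (simp add: sum_ennreal dev_prob_nonneg[OF D] sum_dev_prob[OF D])
    finally show "(\<integral>\<^sup>+ d. ennreal (dev_prob D 0 d) \<partial>count_space UNIV) = 1" .
  qed (simp add: dev_prob_nonneg[OF D])
  then show ?thesis
    by (simp add: dev_prob_time_invariant[of t])
qed

lemma set_dev_pmf: "set_pmf (dev_pmf D) \<subseteq> dev_values D"
  using dev_prob_eq_0 by (auto simp: set_pmf_eq pmf_dev_pmf[of _ 0])

lemma finite_set_dev_pmf: "finite (set_pmf (dev_pmf D))"
  using set_dev_pmf finite_dev_values[OF D] by (rule finite_subset)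

text \<open>Both kinds of transition move to a fixed next state \<open>s'\<close> and pay a function \<open>f\<close> of the
  deviation. Their dynamics sum the probabilities of the deviations that produce a given reward,
  which is the mass function of an image measure.\<close>

lemma embed_pmf_dev_sum:
  assumes "s' \<in> S" and "\<And>d. d \<in> dev_values D \<Longrightarrow> f d \<in> R"
    and "\<And>u. u \<in> S \<Longrightarrow> Q u \<longleftrightarrow> u = s'"
  shows "embed_pmf (\<lambda>(u, r). if u \<in> S \<and> r \<in> R
      then if Q u then \<Sum>d \<in> {d \<in> dev_values D. r = f d}. dev_prob D t d else 0 else 0) =
    map_pmf (\<lambda>d. (s', f d)) (dev_pmf D)" (is "embed_pmf ?g = ?p")
proof -
  have "?g y = pmf ?p y" for y
  proof -
    obtain u r where y: "y = (u, r)" by (cases y)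
    have "pmf ?p y = (\<Sum>d \<in> {d \<in> dev_values D. u = s' \<and> r = f d}. dev_prob D t d)"
      by (simp add: y pmf_map_pmf_sum[OF finite_dev_values[OF D] set_dev_pmf] pmf_dev_pmf[of _ t])
    moreover have "{d \<in> dev_values D. u = s' \<and> r = f d} = {}" if "\<not> (u = s' \<and> r \<in> R)"
      using that assms(2) by auto
    ultimately show ?thesis
      using assms(1,3) unfolding y
      by (cases "u = s' \<and> r \<in> R")
         (auto simp only: prod.case sum.empty simp_thms if_True if_False split: if_split)
  qed
  then have "?g = pmf ?p" ..
  then show ?thesis
    by (simp only: embed_pmf_pmf)
qed

lemma transition_pmf_nv_mdp:
  assumes "a \<in> orders D t"
  shows "transition_pmf (nv_mdp D) (nv_state D t) a =
    map_pmf (\<lambda>d. (nv_state D (t + 1), Rew D t a d)) (dev_pmf D)"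
  unfolding transition_pmf_def states_simps[OF D]
  using embed_pmf_dev_sum[where S = "nv_states D" and R = "rewards (nv_mdp D)"
      and Q = "\<lambda>u. period D u = t + 1" and s' = "nv_state D (t + 1)" and f = "Rew D t a" and t = t]
    dev_rewards[OF D assms] period_next[OF D]
  by (simp add: nv_mdp_def[THEN arg_cong[where f = dyn]] D Let_def nv_states_def cong: if_cong)

lemma transition_pmf_nv_quotient:
  assumes "x \<in> dev_values D"
  shows "transition_pmf (nv_quotient D) (nv_states D) x =
    map_pmf (\<lambda>d. (nv_states D,
        Rew D 0 (x + int (forecast D 0)) d - Rew D 0 (int (forecast D 0)) d)) (dev_pmf D)"
proof -
  have "x + int (forecast D 0) \<in> orders D 0"
    using assms by (simp add: orders_def add.commute)
  then show ?thesis
    unfolding transition_pmf_def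
    using embed_pmf_dev_sum[where S = "{nv_states D}" and R = "rewards (nv_mdp' D)"
        and Q = "\<lambda>u. True" and s' = "nv_states D" and t = 0
        and f = "\<lambda>d. Rew D 0 (x + int (forecast D 0)) d - Rew D 0 (int (forecast D 0)) d"]
      dev_rewards'[OF D]
    by (simp add: nv_quotient_def nv_mdp''_def nv_mdp'_def D Let_def cong: if_cong)
qed

lemma actions_at_state: "actions_at (nv_mdp D) (nv_state D t) = orders D t"
  by (simp add: actions_at_nv[OF D] nv_states_def D)

lemma actions_at_quotient: "actions_at (nv_quotient D) (nv_states D) = dev_values D"
  by (simp add: actions_at_def nv_quotient_def)

lemma finite_orders: "finite (orders D t)"
  by (simp add: orders_def finite_dev_values[OF D])

lemma sum_orders: "(\<Sum>a \<in> orders D t. g a) = (\<Sum>x \<in> dev_values D. g (x + int (forecast D t)))"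
  unfolding orders_def by (subst sum.reindex) (auto simp: inj_on_def add.commute)

text \<open>By \<open>Rew_relative\<close>, every order gains the same \<open>c\<^sub>t\<close> over its counterpart in the quotient,
  namely the expected reward of ordering the forecast; as the weights sum to 1, so does their
  average.\<close>

lemma val_shift:
  assumes \<rho>: "\<rho> \<in> policies (nv_mdp D)" and \<pi>: "\<pi> \<in> policies (nv_quotient D)"
    and eq: "\<And>x. x \<in> dev_values D \<Longrightarrow>
      \<rho> (nv_state D t, x + int (forecast D t)) = \<pi> (nv_states D, x)"
  shows "val (nv_mdp D) \<rho> (nv_state D t) = val (nv_quotient D) \<pi> (nv_states D) +
    measure_pmf.expectation (dev_pmf D) (Rew D t (int (forecast D t)))"
proof -
  let ?E = "measure_pmf.expectation (dev_pmf D)"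
  let ?c = "?E (Rew D t (int (forecast D t)))"
  let ?q = "\<lambda>x. ?E (\<lambda>d. Rew D 0 (x + int (forecast D 0)) d - Rew D 0 (int (forecast D 0)) d)"
  have one: "(\<Sum>x \<in> dev_values D. \<pi> (nv_states D, x)) = 1"
    using \<pi> by (simp add: policies_def nv_quotient_def actions_at_def)
  have val_quotient: "val (nv_quotient D) \<pi> (nv_states D) =
      (\<Sum>x \<in> dev_values D. \<pi> (nv_states D, x) * ?q x)"
    using val_eq_sum[OF _ _ \<pi>, of "nv_states D"]
    by (simp add: actions_at_quotient finite_dev_values[OF D] transition_pmf_nv_quotient
        finite_set_dev_pmf nv_quotient_def[THEN arg_cong[where f = states]])
  have Rew_split: "?E (Rew D t (x + int (forecast D t))) = ?q x + ?c" for x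
  proof -
    have "?E (Rew D t (x + int (forecast D t))) =
        ?E (\<lambda>d. (Rew D 0 (x + int (forecast D 0)) d - Rew D 0 (int (forecast D 0)) d)
              + Rew D t (int (forecast D t)) d)"
      by (simp add: Rew_relative[of D 0 x _ t])
    also have "\<dots> = ?q x + ?c"
      by (intro Bochner_Integration.integral_add integrable_measure_pmf_finite finite_set_dev_pmf)
    finally show ?thesis .
  qed
  have "val (nv_mdp D) \<rho> (nv_state D t) =
      (\<Sum>a \<in> orders D t. \<rho> (nv_state D t, a) * ?E (Rew D t a))"
    using val_eq_sum[OF _ _ \<rho>, of "nv_state D t"]
    by (simp add: actions_at_state finite_orders transition_pmf_nv_mdp finite_set_dev_pmf
        states_simps[OF D] nv_states_def)
  also have "\<dots> = (\<Sum>x \<in> dev_values D. \<pi> (nv_states D, x) * ?q x + \<pi> (nv_states D, x) * ?c)"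
    unfolding sum_orders by (intro sum.cong refl) (simp add: eq Rew_split distrib_left)
  also have "\<dots> = val (nv_quotient D) \<pi> (nv_states D) + ?c"
    by (simp add: sum.distrib sum_distrib_right[symmetric] one val_quotient)
  finally show ?thesis .
qed

lemma admissible_nv_state: "(nv_state D t, a) \<in> admissible (nv_mdp D) \<longleftrightarrow> a \<in> orders D t"
  by (simp add: nv_mdp_def nv_states_def D)

lemma Lambda_nv_state:
  "a \<in> orders D t \<Longrightarrow> Lambda D \<pi> (nv_state D t, a) = \<pi> (nv_states D, a - int (forecast D t))"
  by (simp add: Lambda_def admissible_nv_state D)

lemma Lambda_shifted:
  "x \<in> dev_values D \<Longrightarrow>
    Lambda D \<pi> (nv_state D t, x + int (forecast D t)) = \<pi> (nv_states D, x)"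
  by (subst Lambda_nv_state) (auto simp: orders_def)

lemma Lambda_policy:
  assumes \<pi>: "\<pi> \<in> policies (nv_quotient D)"
  shows "Lambda D \<pi> \<in> policies (nv_mdp D)"
proof -
  have "\<pi> (nv_states D, x) \<in> {0..1}" if "x \<in> dev_values D" for x
    using \<pi> that by (auto simp: policies_def nv_quotient_def)
  then have "Lambda D \<pi> \<in> admissible (nv_mdp D) \<rightarrow>\<^sub>E {0..1}"
    unfolding Lambda_def
    by (intro restrict_PiE_iff[THEN iffD2]) (auto simp: nv_mdp_def orders_def)
  moreover have "(\<Sum>a \<in> orders D t. Lambda D \<pi> (nv_state D t, a)) = 1" for t
    using \<pi> by (simp add: sum_orders Lambda_shifted policies_def nv_quotient_def actions_at_def)
  ultimately show ?thesis
    by (auto simp: policies_def states_simps[OF D] nv_states_def actions_at_state)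
qed

text \<open>A policy of the newsvendor MDP may use different relative weights in different periods, so
  it need not be in the range of \<open>\<Lambda>\<close>. With discount factor 0 only the weights of one period enter
  the value at one state, and optimality can be compared one period at a time.\<close>

lemma slice_policy:
  assumes \<rho>: "\<rho> \<in> policies (nv_mdp D)"
  shows "(\<lambda>(s, x) \<in> {nv_states D} \<times> dev_values D. \<rho> (nv_state D t, x + int (forecast D t)))
    \<in> policies (nv_quotient D)" (is "?\<sigma> \<in> _")
proof -
  have "\<rho> (nv_state D t, x + int (forecast D t)) \<in> {0..1}" if "x \<in> dev_values D" for x
  proof -
    have "(nv_state D t, x + int (forecast D t)) \<in> admissible (nv_mdp D)"
      using that by (simp add: admissible_nv_state orders_def add.commute)
    then show ?thesis
      using \<rho> by (auto simp: policies_def)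
  qed
  moreover have "(\<Sum>x \<in> dev_values D. \<rho> (nv_state D t, x + int (forecast D t))) = 1"
    using \<rho> unfolding sum_orders[of "\<lambda>a. \<rho> (nv_state D t, a)", symmetric]
    by (simp add: policies_def states_simps[OF D] nv_states_def actions_at_state)
  ultimately show ?thesis
    by (auto simp: policies_def nv_quotient_def actions_at_def)
qed

lemma Lambda_optimal:
  assumes \<pi>: "\<pi> \<in> optimal_policies (nv_quotient D)"
  shows "Lambda D \<pi> \<in> optimal_policies (nv_mdp D)"
proof (rule optimal_policyI)
  have \<pi>': "\<pi> \<in> policies (nv_quotient D)"
    using \<pi> by (simp add: optimal_policies_def)
  then show pol: "Lambda D \<pi> \<in> policies (nv_mdp D)"
    by (rule Lambda_policy)
  fix \<rho> s assume \<rho>: "\<rho> \<in> policies (nv_mdp D)" and "s \<in> states (nv_mdp D)"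
  then obtain t where s: "s = nv_state D t"
    by (auto simp: states_simps[OF D] nv_states_def)
  let ?\<sigma> = "\<lambda>(s, x) \<in> {nv_states D} \<times> dev_values D. \<rho> (nv_state D t, x + int (forecast D t))"
  have "val (nv_quotient D) ?\<sigma> (nv_states D) \<le> val (nv_quotient D) \<pi> (nv_states D)"
    by (rule optimal_policy_val_ge[OF \<pi> slice_policy[OF \<rho>]])
       (simp_all add: actions_at_quotient finite_dev_values[OF D] transition_pmf_nv_quotient
        finite_set_dev_pmf nv_quotient_def[THEN arg_cong[where f = states]])
  then show "val (nv_mdp D) \<rho> s \<le> val (nv_mdp D) (Lambda D \<pi>) s"
    using val_shift[OF \<rho> slice_policy[OF \<rho>], of t t] val_shift[OF pol \<pi>', of t]
    by (simp add: s Lambda_shifted)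
qed

lemma inj_on_Lambda: "inj_on (Lambda D) (policies (nv_quotient D))"
proof (rule inj_onI)
  fix \<pi> \<pi>' assume pol: "\<pi> \<in> policies (nv_quotient D)" "\<pi>' \<in> policies (nv_quotient D)"
    and eq: "Lambda D \<pi> = Lambda D \<pi>'"
  have "\<pi> (nv_states D, x) = \<pi>' (nv_states D, x)" if "x \<in> dev_values D" for x
    using Lambda_shifted[OF that, of \<pi> 0] Lambda_shifted[OF that, of \<pi>' 0] eq by simp
  then show "\<pi> = \<pi>'"
    using pol by (intro PiE_ext[where k = "admissible (nv_quotient D)" and s = "\<lambda>_. {0..1}"])
      (auto simp: policies_def nv_quotient_def)
qed

end

theorem mainTheorem4:
  fixes D :: "('w, 's) newsvendor"
  assumes "is_newsvendor D"
  shows "(\<forall>\<pi> \<in> optimal_policies (nv_quotient D). \<forall>t a.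
            (nv_state D t, a) \<in> admissible (nv_mdp D) \<longrightarrow>
            Lambda D \<pi> (nv_state D t, a) = \<pi> (nv_states D, a - int (forecast D t)))
       \<and> Lambda D \<in> optimal_policies (nv_quotient D) \<rightarrow> optimal_policies (nv_mdp D)
       \<and> inj_on (Lambda D) (optimal_policies (nv_quotient D))"
proof (intro conjI ballI allI impI funcsetI)
  show "Lambda D \<pi> (nv_state D t, a) = \<pi> (nv_states D, a - int (forecast D t))"
    if "(nv_state D t, a) \<in> admissible (nv_mdp D)" for \<pi> t a
    using that by (simp add: admissible_nv_state Lambda_nv_state assms)
  show "Lambda D \<pi> \<in> optimal_policies (nv_mdp D)"
    if "\<pi> \<in> optimal_policies (nv_quotient D)" for \<pi>
    using assms that by (rule Lambda_optimal)
  show "inj_on (Lambda D) (optimal_policies (nv_quotient D))"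
    using inj_on_Lambda[OF assms]
    by (rule inj_on_subset) (auto simp: optimal_policies_def)
qed

end
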